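(* Let $x:[0,1]\to\mathbb{R}$ be the horizontal component of the Peano curve. There exists a local time of $x$ (with respect to the Lebesgue measure) which attains values no greater than $1$; that is, there exists a function $L:[0,1]\times\mathbb{R}\to[0,+\infty)$, $(t,z)\mapsto L_t^z$, with $L_t^z\le1$ for all $(t,z)$, such that for every $t\in[0,1]$ the function $z\mapsto L_t^z$ is Borel measurable and for every bounded Borel-measurable function $g:\mathbb{R}\to\mathbb{R}$ $$\int_0^t g(x(s))\,ds=\int_{\mathbb{R}}g(z)\,L_t^z\,dz .$$
   Context: Horizontal component of the Peano curve: for $t\in[0,1]$ write a ternary expansion $t=\sum_{j\ge1}t_j3^{-j}$ with $t_j\in\{0,1,2\}$ (for $t=1$ all $t_j=2$). Let $\kappa:\{0,1,2\}\to\{0,1,2\}$, $\kappa(d)=2-d$, and let $\kappa^{v}$ be its $v$-th iterate ($\kappa^0=\mathrm{id}$). Then $$x(t)=\sum_{j\ge1}3^{-j}\,\kappa^{\,t_2+t_4+\dots+t_{2j-2}}(t_{2j-1}),$$ where for $j=1$ the exponent of $\kappa$ is $0$. The value does not depend on the choice of ternary expansion of $t$, and $x$ is a continuous function from $[0,1]$ onto $[0,1]$. *)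

theory Defs
  imports "HOL-Analysis.Analysis"
begin

text \<open>Digit sequences are indexed from 1; the value at index 0 is irrelevant.\<close>

definition ternary_expansion :: "(nat \<Rightarrow> nat) \<Rightarrow> real \<Rightarrow> bool" where
  "ternary_expansion d t \<longleftrightarrow>
     (\<forall>j\<ge>1. d j \<in> {0, 1, 2}) \<and> (\<lambda>j. real (d (Suc j)) / 3 ^ Suc j) sums t"

definition kappa :: "nat \<Rightarrow> nat" where
  "kappa d = 2 - d"

text \<open>The summation index \<open>j\<close> starts at 0 here, so the term below is the usual
  \<open>(j + 1)\<close>-st one, with digit \<open>d (2 * (j + 1) - 1)\<close>.\<close>

definition peano_series :: "(nat \<Rightarrow> nat) \<Rightarrow> real" where
  "peano_series d =
     (\<Sum>j. real ((kappa ^^ (\<Sum>i=1..j. d (2 * i))) (d (2 * j + 1))) / 3 ^ Suc j)"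

text \<open>The horizontal component of the Peano curve, of interest only on \<open>{0..1}\<close>, where an
  expansion exists (lemma below) and the value is independent of the one chosen.\<close>

definition peano_x :: "real \<Rightarrow> real" where
  "peano_x t = peano_series (SOME d. ternary_expansion d t)"

lemma ternary_expansion_exists:
  assumes "t \<in> {0..1}"
  shows "\<exists>d. ternary_expansion d t"
proof (cases "t = 1")
  case True
  have "(\<lambda>j. (2/3) * (1/3) ^ j) sums ((2/3) * (1 / (1 - 1/3 :: real)))"
    by (intro sums_mult geometric_sums) simp
  then have "(\<lambda>j. real 2 / 3 ^ Suc j) sums 1"
    by (simp add: power_divide)
  then have "ternary_expansion (\<lambda>_. 2) t"
    using True by (simp add: ternary_expansion_def)
  then show ?thesis by blast
next
  case False
  define a where "a n = \<lfloor>3 ^ n * t\<rfloor>" for n :: nat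
  define d where "d n = nat (a n - 3 * a (n - 1))" for n :: nat
  have bounds: "0 \<le> a (Suc n) - 3 * a n \<and> a (Suc n) - 3 * a n \<le> 2" for n
    unfolding a_def power_Suc by linarith
  have digits: "d j \<in> {0, 1, 2}" if "j \<ge> 1" for j
    using bounds[of "j - 1"] that by (auto simp: d_def)
  have lim: "(\<lambda>n. of_int (a n) / 3 ^ n) \<longlonglongrightarrow> t"
  proof (rule tendsto_sandwich)
    show "\<forall>\<^sub>F n in sequentially. t - (1/3) ^ n \<le> of_int (a n) / 3 ^ n"
    proof (intro always_eventually allI)
      fix n
      have "3 ^ n * t - 1 \<le> of_int (a n)" unfolding a_def by linarith
      then have "(3 ^ n * t - 1) / 3 ^ n \<le> of_int (a n) / 3 ^ n"
        by (rule divide_right_mono) simp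
      then show "t - (1/3) ^ n \<le> of_int (a n) / 3 ^ n"
        by (simp add: diff_divide_distrib power_divide)
    qed
    show "\<forall>\<^sub>F n in sequentially. of_int (a n) / 3 ^ n \<le> t"
      by (intro always_eventually allI) (simp add: a_def field_simps)
    show "(\<lambda>n. t - (1/3) ^ n) \<longlonglongrightarrow> t"
      using tendsto_diff[OF tendsto_const LIMSEQ_power_zero[of "1/3 :: real"], of t] by simp
  qed simp
  have "a 0 = 0"
    using assms False by (simp add: a_def floor_eq_iff)
  then have "(\<lambda>n. of_int (a (Suc n)) / 3 ^ Suc n - of_int (a n) / 3 ^ n) sums t"
    using telescope_sums[OF lim] by simp
  moreover have "of_int (a (Suc n)) / 3 ^ Suc n - of_int (a n) / 3 ^ n
      = real (d (Suc n)) / 3 ^ Suc n" for n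
    using bounds[of n] by (simp add: d_def field_simps)
  ultimately have "ternary_expansion d t"
    using digits by (simp add: ternary_expansion_def)
  then show ?thesis by blast
qed

text \<open>Local time on the time interval \<open>{0..1}\<close> with respect to Lebesgue measure. The
  integrability clauses are stated because \<open>integral\<^sup>L\<close> is 0 on non-integrable functions.\<close>

definition is_local_time :: "(real \<Rightarrow> real) \<Rightarrow> (real \<Rightarrow> real \<Rightarrow> real) \<Rightarrow> bool" where
  "is_local_time x L \<longleftrightarrow>
     (\<forall>t\<in>{0..1}. (\<forall>z. 0 \<le> L t z) \<and> L t \<in> borel_measurable borel \<and>
       (\<forall>g :: real \<Rightarrow> real. g \<in> borel_measurable borel \<and> bounded (range g) \<longrightarrow>
          set_integrable lborel {0..t} (\<lambda>s. g (x s)) \<and>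
          integrable lborel (\<lambda>z. g z * L t z) \<and>
          (LINT s:{0..t}|lborel. g (x s)) = (LINT z|lborel. g z * L t z)))"

end

theory Submission
  imports Defs "HOL-Probability.Levy"
begin

text \<open>With \<open>R z = 1 - z\<close>, reading off two ternary digits gives the self-similarity
  \<open>x ((3 a + b + s) / 9) = (a + R\<^sup>b (x s)) / 3\<close> for digits \<open>a\<close>, \<open>b\<close> and \<open>s \<in> [0, 1)\<close>. Lebesgue measure on
  \<open>[0, 1)\<close> satisfies the same self-similarity, whose solution is unique by contraction on Lipschitz
  test functions; hence \<open>x\<close> preserves Lebesgue measure. The occupation measure of \<open>x\<close> up to time \<open>t\<close>
  is therefore dominated by Lebesgue measure, and its Radon--Nikodym density, truncated at \<open>1\<close>, is the
  local time.\<close>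

section \<open>Ternary digits and self-similarity\<close>

lemma kappa_funpow:
  assumes "d \<le> 2"
  shows "(kappa ^^ n) d = (if even n then d else 2 - d)"
  using assms by (induction n) (auto simp: kappa_def)

lemma sums_two_thirds: "(\<lambda>j. 2 / 3 ^ Suc j :: real) sums 1"
proof -
  have "(\<lambda>j. (2/3) * (1/3) ^ j) sums ((2/3) * (1 / (1 - 1/3 :: real)))"
    by (intro sums_mult geometric_sums) simp
  then show ?thesis by (simp add: power_divide)
qed

lemma summable_ternary:
  fixes e :: "nat \<Rightarrow> nat"
  assumes "\<And>j. e j \<le> 2"
  shows "summable (\<lambda>j. real (e j) / 3 ^ Suc j)"
proof (rule summable_comparison_test')
  show "summable (\<lambda>j. 2 / 3 ^ Suc j :: real)"
    using sums_two_thirds by (rule sums_summable)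
  show "norm (real (e j) / 3 ^ Suc j) \<le> 2 / 3 ^ Suc j" if "j \<ge> 0" for j
    using assms[of j] by (simp add: divide_right_mono)
qed

lemma ternary_sums_bounds:
  fixes e :: "nat \<Rightarrow> nat"
  assumes "\<And>j. e j \<le> 2" and "(\<lambda>j. real (e j) / 3 ^ Suc j) sums r"
  shows "r \<in> {0..1}"
proof -
  have "r \<le> 1"
    using assms(2) sums_two_thirds
  proof (rule sums_le[rotated])
    show "real (e j) / 3 ^ Suc j \<le> 2 / 3 ^ Suc j" for j
      using assms(1)[of j] by (intro divide_right_mono) auto
  qed
  moreover have "0 \<le> r"
    using sums_zero assms(2) by (rule sums_le[rotated]) simp
  ultimately show ?thesis by simp
qed

lemma peano_series_cong:
  assumes "\<And>j. j \<ge> 1 \<Longrightarrow> d j = d' j"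
  shows "peano_series d = peano_series d'"
proof -
  have "(\<Sum>i=1..j. d (2 * i)) = (\<Sum>i=1..j. d' (2 * i))" for j
    using assms by (intro sum.cong) auto
  then show ?thesis using assms by (simp add: peano_series_def)
qed

lemma peano_series_in_unit:
  assumes "\<And>j. j \<ge> 1 \<Longrightarrow> d j \<le> 2"
  shows "peano_series d \<in> {0..1}"
  unfolding peano_series_def
  by (rule ternary_sums_bounds[OF _ summable_sums[OF summable_ternary]])
     (use assms in \<open>auto simp: kappa_funpow\<close>)

text \<open>Every exponent of \<open>kappa\<close> from the second term on contains
  \<open>d 2\<close>. As \<open>kappa\<close> is an involution on digits, only its parity counts: an
  odd \<open>d 2\<close> turns each later digit \<open>e\<close> into \<open>2 - e\<close>. Because
  the terms \<open>2 / 3 ^ Suc j\<close> add up to 1, this turns the remaining sum \<open>z\<close>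
  into \<open>1 - z\<close>.\<close>

lemma peano_series_shift:
  assumes "\<And>j. j \<ge> 1 \<Longrightarrow> d j \<le> 2"
  shows "peano_series d =
    (d 1 + (if even (d 2) then peano_series (\<lambda>j. d (j + 2))
            else 1 - peano_series (\<lambda>j. d (j + 2)))) / 3"
proof -
  define e where "e j = (kappa ^^ (\<Sum>i=1..j. d (2 * i))) (d (2 * j + 1))" for j
  define e' where "e' j = (kappa ^^ (\<Sum>i=1..j. d (2 * i + 2))) (d (2 * j + 3))" for j
  have le: "e j \<le> 2" "e' j \<le> 2" for j
    using assms by (auto simp: e_def e'_def kappa_funpow)
  have "(\<Sum>i=1..Suc j. d (2 * i)) = d 2 + (\<Sum>i=1..j. d (2 * i + 2))" for j
    by (induction j) simp_all
  then have step: "e (Suc j) = (if even (d 2) then e' j else 2 - e' j)" for j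
    using assms unfolding e_def e'_def by (auto simp: kappa_funpow numeral_3_eq_3)
  have e': "(\<lambda>j. real (e' j) / 3 ^ Suc j) sums peano_series (\<lambda>j. d (j + 2))"
    using summable_sums[OF summable_ternary, of e'] le
    by (simp add: peano_series_def e'_def numeral_3_eq_3)
  have "(\<lambda>j. real (e (Suc j)) / 3 ^ Suc j) sums
      (if even (d 2) then peano_series (\<lambda>j. d (j + 2)) else 1 - peano_series (\<lambda>j. d (j + 2)))"
    using e' sums_diff[OF sums_two_thirds e'] le
    by (simp add: step of_nat_diff diff_divide_distrib)
  from sums_divide[OF this, of 3]
  have "(\<lambda>j. real (e (Suc j)) / 3 ^ Suc (Suc j)) sums
      ((if even (d 2) then peano_series (\<lambda>j. d (j + 2)) else 1 - peano_series (\<lambda>j. d (j + 2))) / 3)"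
    by (simp add: mult.commute)
  then have "(\<lambda>j. real (e j) / 3 ^ Suc j) sums
      ((if even (d 2) then peano_series (\<lambda>j. d (j + 2)) else 1 - peano_series (\<lambda>j. d (j + 2))) / 3
        + e 0 / 3 ^ Suc 0)"
    by (subst (asm) sums_Suc_iff)
  moreover have "e 0 = d 1" by (simp add: e_def)
  moreover have "peano_series d = (\<Sum>j. real (e j) / 3 ^ Suc j)"
    by (simp add: peano_series_def e_def)
  ultimately show ?thesis
    by (simp add: sums_iff add_divide_distrib)
qed

text \<open>The digits depend on an explicit floor, which makes them Borel functions of
  \<open>t\<close> on the whole line. At \<open>t = 1\<close> all digits of positive index are 0,
  not 2, so later arguments work on \<open>{0..<1}\<close>.\<close>

definition tdigit :: "real \<Rightarrow> nat \<Rightarrow> nat" where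
  "tdigit t j = nat (\<lfloor>3 ^ j * t\<rfloor> mod 3)"

lemma tdigit_le: "tdigit t j \<le> 2"
proof -
  have "\<lfloor>3 ^ j * t\<rfloor> mod 3 < 3" by (rule pos_mod_bound) simp
  then show ?thesis by (simp add: tdigit_def)
qed

text \<open>The Peano series of the floor expansion. It can differ from \<^const>\<open>peano_x\<close>, which evaluates an
  arbitrarily chosen expansion, only at the countably many points with two expansions, so
  independence of the expansion is never needed.\<close>

definition peano_floor :: "real \<Rightarrow> real" where
  "peano_floor t = peano_series (tdigit t)"

lemma peano_floor_in_unit: "peano_floor t \<in> {0..1}"
  unfolding peano_floor_def by (rule peano_series_in_unit) (rule tdigit_le)

lemma measurable_peano_floor [measurable]: "peano_floor \<in> borel_measurable borel"
proof -
  have [measurable]: "(\<lambda>t. tdigit t j) \<in> borel \<rightarrow>\<^sub>M count_space UNIV" for j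
    unfolding tdigit_def by measurable
  \<comment> \<open>The iterate of \<open>kappa\<close>, whose exponent varies with
    \<open>t\<close>, becomes a case distinction on parity, which is visibly measurable.\<close>
  have "(\<lambda>t. real ((kappa ^^ (\<Sum>i=1..j. tdigit t (2 * i))) (tdigit t (2 * j + 1))) / 3 ^ Suc j)
      = (\<lambda>t. if even (\<Sum>i=1..j. tdigit t (2 * i)) then tdigit t (2 * j + 1) / 3 ^ Suc j
             else (2 - real (tdigit t (2 * j + 1))) / 3 ^ Suc j)" for j
    using tdigit_le by (auto simp: kappa_funpow of_nat_diff)
  then show ?thesis
    unfolding peano_floor_def[abs_def] peano_series_def by measurable
qed

lemma peano_floor_self_similar:
  assumes s: "s \<in> {0..<1}" and ab: "a < 3" "b < 3"
  shows "peano_floor ((3 * real a + real b + s) / 9) =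
    (a + (if even b then peano_floor s else 1 - peano_floor s)) / 3"
proof -
  let ?t = "(3 * real a + real b + s) / 9"
  have "\<lfloor>3 * ?t\<rfloor> = int a" "\<lfloor>9 * ?t\<rfloor> = 3 * int a + int b"
    using s ab by (auto simp: floor_eq_iff)
  then have 12: "tdigit ?t 1 = a" "tdigit ?t 2 = b"
    using ab by (simp_all add: tdigit_def)
  have "tdigit ?t (j + 2) = tdigit s j" if j: "j \<ge> 1" for j
  proof -
    obtain i where i: "j = Suc i" using j by (cases j) auto
    \<comment> \<open>The two leading digits contribute an integer that is divisible by 3 because
      \<open>j\<close> is positive, so it disappears modulo 3.\<close>
    have "3 ^ (j + 2) * ?t = of_int (3 ^ j * (3 * int a + int b)) + 3 ^ j * s"
      by (simp add: power_add algebra_simps)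
    then have "\<lfloor>3 ^ (j + 2) * ?t\<rfloor> = 3 ^ j * (3 * int a + int b) + \<lfloor>3 ^ j * s\<rfloor>"
      by (simp only: floor_add_int[symmetric] add.commute)
    also have "\<dots> mod 3 = \<lfloor>3 ^ j * s\<rfloor> mod 3"
      unfolding i power_Suc mult.assoc by (rule mod_mult_self4)
    finally show ?thesis by (simp add: tdigit_def)
  qed
  then have "peano_series (\<lambda>j. tdigit ?t (j + 2)) = peano_floor s"
    unfolding peano_floor_def by (intro peano_series_cong)
  then show ?thesis
    unfolding peano_floor_def[of ?t]
    by (subst peano_series_shift) (simp_all only: tdigit_le 12)
qed

section \<open>Uniqueness of ternary expansions off a countable set\<close>

definition triadic_rationals :: "real set" where
  "triadic_rationals = (\<lambda>(k, n). of_int k / 3 ^ n) ` (UNIV :: (int \<times> nat) set)"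

lemma countable_triadic: "countable triadic_rationals"
  unfolding triadic_rationals_def by simp

text \<open>The tail after \<open>n\<close> digits, scaled by \<open>3 ^ n\<close>, lies in
  \<open>{0..1}\<close>. Off the triadic rationals \<open>3 ^ n * t\<close> is not an integer, so
  the integer formed by the first \<open>n\<close> digits must be its floor.\<close>

lemma ternary_expansion_unique:
  assumes d: "ternary_expansion d t" and t: "t \<notin> triadic_rationals" and j: "j \<ge> 1"
  shows "d j = tdigit t j"
proof -
  \<comment> \<open>\<open>p n\<close> is the integer written in base 3 as \<open>d 1\<close>, ...,
    \<open>d n\<close>.\<close>
  define p where "p = rec_nat (0 :: int) (\<lambda>n x. 3 * x + int (d (Suc n)))"
  have p: "p 0 = 0" "p (Suc n) = 3 * p n + int (d (Suc n))" for n
    by (simp_all add: p_def)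
  have le: "d (Suc j) \<le> 2" for j
  proof -
    have "\<forall>j\<ge>1. d j \<in> {0, 1, 2}" using d unfolding ternary_expansion_def by blast
    from this[rule_format, of "Suc j"] show ?thesis by auto
  qed
  have tail: "(\<lambda>j. real (d (Suc (j + n))) / 3 ^ Suc j) sums (3 ^ n * t - p n)" for n
  proof (induction n)
    case 0
    then show ?case using d by (simp add: ternary_expansion_def p)
  next
    case (Suc n)
    have "(\<lambda>j. real (d (Suc (Suc j + n))) / 3 ^ Suc (Suc j)) sums
        (3 ^ n * t - p n - d (Suc n) / 3)"
      using Suc by (subst sums_Suc_iff) simp
    from sums_mult[OF this, of 3] show ?case
      by (simp add: p algebra_simps)
  qed
  have floor: "\<lfloor>3 ^ n * t\<rfloor> = p n" for n
  proof -
    have "3 ^ n * t - p n \<in> {0..1}"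
      by (rule ternary_sums_bounds[OF _ tail]) (rule le)
    moreover have "3 ^ n * t \<noteq> of_int k" for k
    proof
      assume "3 ^ n * t = of_int k"
      then have "t = of_int k / 3 ^ n" by (simp add: field_simps)
      then show False using t by (auto simp: triadic_rationals_def image_iff)
    qed
    \<comment> \<open>Only the right endpoint has to be excluded: it is the case of a tail
      consisting entirely of 2s.\<close>
    from this[of "p n + 1"] have "3 ^ n * t \<noteq> p n + 1" by simp
    ultimately show ?thesis by (simp add: floor_eq_iff)
  qed
  obtain n where "j = Suc n" using j by (cases j) auto
  then show ?thesis using le[of n] by (simp add: tdigit_def floor p del: power_Suc)
qed

lemma peano_x_eq_peano_floor:
  assumes "t \<in> {0..1}" "t \<notin> triadic_rationals"
  shows "peano_x t = peano_floor t"
proof -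
  have "ternary_expansion (SOME d. ternary_expansion d t) t"
    using ternary_expansion_exists[OF assms(1)] by (rule someI_ex)
  then show ?thesis
    unfolding peano_x_def peano_floor_def
    by (intro peano_series_cong ternary_expansion_unique assms)
qed

section \<open>Preservation of Lebesgue measure\<close>

text \<open>The uniform distribution on \<open>{0..<1}\<close>, kept as a measure on the whole line
  so that characteristic functions apply. The half-open interval splits exactly into scaled copies
  of itself.\<close>

definition unit_measure :: "real measure" where
  "unit_measure = density lborel (\<lambda>s. ennreal (indicator {0..<1} s))"

lemma sets_unit_measure [simp, measurable_cong]: "sets unit_measure = sets borel"
  by (simp add: unit_measure_def)

lemma emeasure_unit_measure:
  "A \<in> sets borel \<Longrightarrow> emeasure unit_measure A = emeasure lborel ({0..<1} \<inter> A)"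
  unfolding unit_measure_def
  by (simp add: ennreal_indicator emeasure_restricted)

lemma real_distribution_unit_measure: "real_distribution unit_measure"
  by (intro real_distribution.intro prob_spaceI real_distribution_axioms.intro)
     (simp_all add: emeasure_unit_measure sets_eq_imp_space_eq[OF sets_unit_measure])

interpretation unit_measure: real_distribution unit_measure
  by (rule real_distribution_unit_measure)

lemma integral_unit_measure:
  fixes F :: "real \<Rightarrow> 'a::{banach, second_countable_topology}"
  assumes "F \<in> borel_measurable borel"
  shows "integral\<^sup>L unit_measure F = (\<integral>s. indicator {0..<1} s *\<^sub>R F s \<partial>lborel)"
  unfolding unit_measure_def using assms by (intro integral_density) auto

lemma integrable_unit_measure:
  fixes F :: "real \<Rightarrow> 'a::{banach, second_countable_topology}"
  assumes "F \<in> borel_measurable borel"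
  shows "integrable unit_measure F \<longleftrightarrow> integrable lborel (\<lambda>s. indicator {0..<1} s *\<^sub>R F s)"
  unfolding unit_measure_def using assms by (intro integrable_density) auto

lemma AE_unit_measure: "AE s in unit_measure. s \<in> {0..<1}"
  unfolding unit_measure_def by (subst AE_density) (auto split: split_indicator)

lemma integral_unit_measure_cong:
  fixes F G :: "real \<Rightarrow> 'a::{banach, second_countable_topology}"
  assumes "F \<in> borel_measurable borel" "G \<in> borel_measurable borel"
    and "\<And>s. s \<in> {0..<1} \<Longrightarrow> F s = G s"
  shows "integral\<^sup>L unit_measure F = integral\<^sup>L unit_measure G"
  using assms AE_unit_measure by (intro integral_cong_AE) auto

section \<open>Subdivision and reflection of the unit interval\<close>

lemma indicator_unit_split:
  assumes "m > 0"
  shows "indicator {0..<1} s = (\<Sum>c<m. indicator {0..<1} (real m * s - real c) :: real)"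
proof -
  define k where "k = \<lfloor>real m * s\<rfloor>"
  have k0: "0 \<le> k \<longleftrightarrow> 0 \<le> s" and km: "k < int m \<longleftrightarrow> s < 1"
    using assms by (simp_all add: k_def floor_less_iff zero_le_mult_iff)
  \<comment> \<open>The \<open>c\<close>-th summand selects the points with floor
    \<open>k = c\<close>, so at most one summand is nonzero.\<close>
  have "real m * s - real c \<in> {0..<1} \<longleftrightarrow> k = int c" for c
    unfolding k_def by (auto simp: floor_eq_iff)
  then have "(\<Sum>c<m. indicator {0..<1} (real m * s - real c) :: real)
      = (\<Sum>c<m. if c = nat k then of_bool (0 \<le> k) else 0)"
    by (intro sum.cong) (auto simp: indicator_def)
  also have "\<dots> = of_bool (0 \<le> k \<and> k < int m)"
    using assms by (auto simp: sum.delta)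
  finally show ?thesis by (simp add: k0 km indicator_def)
qed

lemma integral_unit_measure_scale:
  fixes F :: "real \<Rightarrow> 'a::{banach, second_countable_topology}"
  assumes m: "m > 0" and F [measurable]: "F \<in> borel_measurable borel"
    and int: "integrable unit_measure F"
  shows "integral\<^sup>L unit_measure F =
    (1 / real m) *\<^sub>R (\<Sum>c<m. \<integral>s. F ((real c + s) / m) \<partial>unit_measure)"
proof -
  have le: "indicator {0..<1} (real m * s - real c) \<le> (indicator {0..<1} s :: real)"
    if "c < m" for c s
    unfolding indicator_unit_split[OF m, of s]
    using that by (intro member_le_sum) auto
  have "integrable lborel (\<lambda>s. indicator {0..<1} (real m * s - real c) *\<^sub>R F s)" if "c < m" for c
  proof (rule Bochner_Integration.integrable_bound)
    show "integrable lborel (\<lambda>s. indicator {0..<1} s *\<^sub>R F s)"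
      using int by (simp add: integrable_unit_measure)
    show "AE s in lborel. norm (indicator {0..<1} (real m * s - real c) *\<^sub>R F s)
        \<le> norm (indicator {0..<1} s *\<^sub>R F s)"
      using le[OF that] by (intro AE_I2) (simp add: mult_right_mono)
  qed measurable
  then have "(\<Sum>c<m. \<integral>s. indicator {0..<1} (real m * s - real c) *\<^sub>R F s \<partial>lborel)
      = (\<integral>s. (\<Sum>c<m. indicator {0..<1} (real m * s - real c) *\<^sub>R F s) \<partial>lborel)"
    by (intro Bochner_Integration.integral_sum[symmetric]) simp
  also have "\<dots> = integral\<^sup>L unit_measure F"
    unfolding scaleR_sum_left[symmetric] indicator_unit_split[OF m, symmetric]
    by (simp add: integral_unit_measure)
  finally have "(\<Sum>c<m. \<integral>s. indicator {0..<1} (real m * s - real c) *\<^sub>R F s \<partial>lborel)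
      = integral\<^sup>L unit_measure F" .
  \<comment> \<open>Substituting \<open>(c + s) / m\<close> for \<open>s\<close> carries the
    \<open>c\<close>-th piece back to the unit interval, with Jacobian \<open>1 / m\<close>.\<close>
  moreover have "(\<integral>s. indicator {0..<1} (real m * s - real c) *\<^sub>R F s \<partial>lborel)
      = (1 / real m) *\<^sub>R (\<integral>s. F ((real c + s) / m) \<partial>unit_measure)" for c
    using m
    by (subst lborel_integral_real_affine[where c = "1 / m" and t = "c / m"])
       (simp_all add: integral_unit_measure add_divide_distrib distrib_left)
  ultimately show ?thesis by (simp add: scaleR_sum_right)
qed

lemma integral_unit_measure_reflect:
  fixes F :: "real \<Rightarrow> 'a::{banach, second_countable_topology}"
  assumes [measurable]: "F \<in> borel_measurable borel"
  shows "(\<integral>s. F (1 - s) \<partial>unit_measure) = integral\<^sup>L unit_measure F"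
proof -
  have "(\<integral>s. indicator {0..<1} s *\<^sub>R F s \<partial>lborel)
      = (\<integral>s. indicator {0..<1} (1 - s) *\<^sub>R F (1 - s) \<partial>lborel)"
    by (subst lborel_integral_real_affine[where c = "-1" and t = 1]) simp_all
  also have "\<dots> = (\<integral>s. indicator {0..<1} s *\<^sub>R F (1 - s) \<partial>lborel)"
    \<comment> \<open>Reflection turns the interval closed at 0 into the one closed at 1; the
      indicators differ only at these two points.\<close>
    by (rule integral_discrete_difference[where X = "{0, 1}"]) (auto split: split_indicator)
  finally show ?thesis by (simp add: integral_unit_measure)
qed

section \<open>Contraction on Lipschitz test functions\<close>

lemma integrable_unit_measure_lipschitz:
  fixes f :: "real \<Rightarrow> 'a::{banach, second_countable_topology}"
  assumes f: "C-lipschitz_on UNIV f" and [measurable]: "X \<in> borel_measurable borel"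
    and X: "\<And>s. s \<in> {0..<1} \<Longrightarrow> X s \<in> {0..1}"
  shows "integrable unit_measure (\<lambda>s. f (X s))"
proof (rule unit_measure.integrable_const_bound)
  have [measurable]: "f \<in> borel_measurable borel"
    using lipschitz_on_continuous_on[OF f] by (rule borel_measurable_continuous_onI)
  show "(\<lambda>s. f (X s)) \<in> borel_measurable unit_measure" by measurable
  have "norm (f z) \<le> norm (f 0) + C" if "z \<in> {0..1}" for z
  proof -
    have "norm (f z) \<le> norm (f 0) + norm (f z - f 0)"
      by (metis add.commute diff_add_cancel norm_triangle_ineq)
    also have "norm (f z - f 0) \<le> C * norm (z - 0)"
      by (rule lipschitz_on_normD[OF f]) auto
    also have "\<dots> \<le> C * 1"
      using that lipschitz_on_nonneg[OF f] by (intro mult_left_mono) auto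
    finally show ?thesis by simp
  qed
  then show "AE s in unit_measure. norm (f (X s)) \<le> norm (f 0) + C"
    using AE_unit_measure X by (auto elim: eventually_mono)
qed

text \<open>The self-similarity expresses the defect on \<open>f\<close> as an average of the defects on the nine
  functions \<open>f \<circ> S\<close> with \<open>S\<close> a similarity of ratio \<open>1/3\<close>; each has a Lipschitz constant three
  times smaller, so the defect is \<open>0\<close>.\<close>

lemma peano_floor_integral_defect:
  fixes f :: "real \<Rightarrow> 'a::{banach, second_countable_topology}"
  assumes "C-lipschitz_on UNIV f"
  shows "norm ((\<integral>s. f (peano_floor s) \<partial>unit_measure) - integral\<^sup>L unit_measure f) \<le> C / 3 ^ n"
  using assms
proof (induction n arbitrary: f C)
  case 0
  note f = 0
  have int: "integrable unit_measure (\<lambda>s. f (peano_floor s))" "integrable unit_measure f"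
    using integrable_unit_measure_lipschitz[OF f, of peano_floor] peano_floor_in_unit
      integrable_unit_measure_lipschitz[OF f, of "\<lambda>s. s"] by auto
  \<comment> \<open>Both arguments lie in the unit interval, hence at distance at most 1; this
    starts the induction with the bound \<open>C\<close>.\<close>
  have "norm (f (peano_floor s) - f s) \<le> C" if "s \<in> {0..<1}" for s
  proof -
    have "norm (f (peano_floor s) - f s) \<le> C * norm (peano_floor s - s)"
      by (rule lipschitz_on_normD[OF f]) auto
    also have "\<dots> \<le> C * 1"
      using that peano_floor_in_unit[of s] lipschitz_on_nonneg[OF f]
      by (intro mult_left_mono) auto
    finally show ?thesis by simp
  qed
  then have "AE s in unit_measure. norm (f (peano_floor s) - f s) \<le> C"
    using AE_unit_measure by (auto elim: eventually_mono)
  then have "(\<integral>s. norm (f (peano_floor s) - f s) \<partial>unit_measure) \<le> C"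
    using int by (intro unit_measure.integral_le_const) auto
  with int show ?case
    by (simp flip: Bochner_Integration.integral_diff)
       (metis integral_norm_bound order_trans)
next
  case (Suc n)
  note f = Suc.prems
  have [measurable]: "f \<in> borel_measurable borel"
    using lipschitz_on_continuous_on[OF f] by (rule borel_measurable_continuous_onI)
  define h where "h a b z = f ((real a + (if even b then z else 1 - z)) / 3)" for a b :: nat and z
  have h_meas [measurable]: "h a b \<in> borel_measurable borel" for a b
    unfolding h_def by measurable
  have h: "(C / 3)-lipschitz_on UNIV (h a b)" for a b
  proof (rule lipschitz_onI)
    fix x y :: real
    have "dist (h a b x) (h a b y) \<le> C * dist ((real a + (if even b then x else 1 - x)) / 3)
        ((real a + (if even b then y else 1 - y)) / 3)"
      unfolding h_def by (rule lipschitz_onD[OF f]) auto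
    also have "\<dots> = C / 3 * dist x y"
      by (auto simp: dist_real_def simp flip: diff_divide_distrib)
    finally show "dist (h a b x) (h a b y) \<le> C / 3 * dist x y" .
  qed (use lipschitz_on_nonneg[OF f] in simp)
  \<comment> \<open>The interval is cut into thirds twice instead of into ninths once, so that the
    two leading digits \<open>a\<close> and \<open>b\<close> appear directly as summation
    indices.\<close>
  have "(\<integral>s. f (peano_floor s) \<partial>unit_measure)
      = (1/3) *\<^sub>R (\<Sum>a<3. \<integral>s. f (peano_floor ((real a + s) / 3)) \<partial>unit_measure)"
    using integral_unit_measure_scale[of 3 "\<lambda>s. f (peano_floor s)"]
      integrable_unit_measure_lipschitz[OF f, of peano_floor] peano_floor_in_unit by simp
  also have "\<dots> = (1/3) *\<^sub>R (\<Sum>a<3. (1/3) *\<^sub>R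
      (\<Sum>b<3. \<integral>s. f (peano_floor ((real a + (real b + s) / 3) / 3)) \<partial>unit_measure))"
    using integral_unit_measure_scale[of 3 "\<lambda>s. f (peano_floor ((real _ + s) / 3))"]
      integrable_unit_measure_lipschitz[OF f, of "\<lambda>s. peano_floor ((real _ + s) / 3)"]
      peano_floor_in_unit by simp
  also have "\<dots> = (1/9) *\<^sub>R (\<Sum>a<3. \<Sum>b<3. \<integral>s. h a b (peano_floor s) \<partial>unit_measure)"
  proof -
    have "(\<integral>s. f (peano_floor ((real a + (real b + s) / 3) / 3)) \<partial>unit_measure)
        = (\<integral>s. h a b (peano_floor s) \<partial>unit_measure)" if "a < 3" "b < 3" for a b
    proof (rule integral_unit_measure_cong)
      fix s :: real assume "s \<in> {0..<1}"
      moreover have "(real a + (real b + s) / 3) / 3 = (3 * real a + real b + s) / 9"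
        by simp
      ultimately show "f (peano_floor ((real a + (real b + s) / 3) / 3)) = h a b (peano_floor s)"
        using that by (simp only: peano_floor_self_similar h_def)
    qed measurable
    then show ?thesis by (simp add: scaleR_sum_right)
  qed
  finally have eq1: "(\<integral>s. f (peano_floor s) \<partial>unit_measure)
      = (1/9) *\<^sub>R (\<Sum>a<3. \<Sum>b<3. \<integral>s. h a b (peano_floor s) \<partial>unit_measure)" .
  \<comment> \<open>By reflection invariance the integral does not depend on \<open>b\<close>.
    Averaging over \<open>b\<close> is therefore harmless, and the integral of \<open>f\<close>
    becomes an average over the same nine functions.\<close>
  have "integral\<^sup>L unit_measure (h a b) = (\<integral>s. f ((real a + s) / 3) \<partial>unit_measure)" for a b
    using integral_unit_measure_reflect[of "\<lambda>s. f ((real a + s) / 3)"]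
    by (cases "even b") (simp_all add: h_def[abs_def])
  then have "integral\<^sup>L unit_measure f
      = (1/9) *\<^sub>R (\<Sum>a<3. \<Sum>b<3. integral\<^sup>L unit_measure (h a b))"
    using integral_unit_measure_scale[of 3 f]
      integrable_unit_measure_lipschitz[OF f, of "\<lambda>s. s"]
    by (simp add: scaleR_sum_right sum_constant_scaleR)
  with eq1 have "norm ((\<integral>s. f (peano_floor s) \<partial>unit_measure) - integral\<^sup>L unit_measure f)
      = (1/9) * norm (\<Sum>a<3. \<Sum>b<3. (\<integral>s. h a b (peano_floor s) \<partial>unit_measure)
          - integral\<^sup>L unit_measure (h a b))"
    by (simp add: sum_subtractf flip: scaleR_diff_right)
  also have "\<dots> \<le> (1/9) * (\<Sum>a<3::nat. \<Sum>b<3::nat. C / 3 / 3 ^ n)"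
    by (intro mult_left_mono sum_norm_le Suc.IH h) simp
  finally show ?case by simp
qed

lemma integral_peano_floor_lipschitz:
  fixes f :: "real \<Rightarrow> 'a::{banach, second_countable_topology}"
  assumes "C-lipschitz_on UNIV f"
  shows "(\<integral>s. f (peano_floor s) \<partial>unit_measure) = integral\<^sup>L unit_measure f"
proof -
  have "(\<lambda>n. C * (1 / 3) ^ n) \<longlonglongrightarrow> C * 0"
    by (intro tendsto_intros LIMSEQ_power_zero) simp
  then have "(\<lambda>n. C / 3 ^ n) \<longlonglongrightarrow> 0" by (simp add: power_divide)
  then have "norm ((\<integral>s. f (peano_floor s) \<partial>unit_measure) - integral\<^sup>L unit_measure f) \<le> 0"
    by (rule LIMSEQ_le_const) (use peano_floor_integral_defect[OF assms] in blast)
  then show ?thesis by simp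
qed

text \<open>Makes the complex exponentials admissible as test functions, so that characteristic
  functions can be compared. After factoring out a unimodular term, the bound is that
  \<open>iexp u - 1\<close> has modulus at most that of \<open>u\<close>.\<close>

lemma lipschitz_on_iexp: "\<bar>\<theta>\<bar>-lipschitz_on UNIV (\<lambda>z. iexp (\<theta> * z))"
proof (rule lipschitz_onI)
  fix x y :: real
  have "iexp (\<theta> * x) - iexp (\<theta> * y) = iexp (\<theta> * y) * (iexp (\<theta> * (x - y)) - 1)"
    by (simp add: algebra_simps flip: exp_add)
  then show "dist (iexp (\<theta> * x)) (iexp (\<theta> * y)) \<le> \<bar>\<theta>\<bar> * dist x y"
    using iexp_approx1[of "\<theta> * (x - y)" 0]
    by (simp add: dist_norm norm_mult abs_mult)
qed simp

text \<open>The vanishing defect on complex exponentials says that both distributions have the same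
  characteristic function, which determines them.\<close>

lemma distr_peano_floor: "distr unit_measure borel peano_floor = unit_measure"
proof (rule Levy_uniqueness)
  show "real_distribution (distr unit_measure borel peano_floor)"
    by (rule unit_measure.real_distribution_distr) simp
  show "char (distr unit_measure borel peano_floor) = char unit_measure"
  proof
    fix \<theta>
    show "char (distr unit_measure borel peano_floor) \<theta> = char unit_measure \<theta>"
      using integral_peano_floor_lipschitz[OF lipschitz_on_iexp[of \<theta>]]
      by (simp add: char_def integral_distr)
  qed
qed (rule real_distribution_unit_measure)

lemma emeasure_peano_floor_vimage_le:
  assumes [measurable]: "A \<in> sets borel"
  shows "emeasure lborel ({0..<1} \<inter> peano_floor -` A) \<le> emeasure lborel A"
proof -
  have "emeasure lborel ({0..<1} \<inter> peano_floor -` A) = emeasure unit_measure (peano_floor -` A)"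
    by (simp add: emeasure_unit_measure measurable_sets_borel[OF measurable_peano_floor])
  also have "\<dots> = emeasure (distr unit_measure borel peano_floor) A"
    by (simp add: emeasure_distr)
  also have "\<dots> = emeasure lborel ({0..<1} \<inter> A)"
    by (simp add: distr_peano_floor emeasure_unit_measure)
  also have "\<dots> \<le> emeasure lborel A" by (intro emeasure_mono) auto
  finally show ?thesis .
qed

section \<open>The occupation density\<close>

text \<open>Where the Radon--Nikodym derivative exceeds 1, domination forces \<open>N\<close> and
  \<open>M\<close> to agree, so the derivative would equal 1 almost everywhere there; that set is
  null. Truncation at 1 then alters the derivative only on a null set and gives bounds at every
  point.\<close>

lemma (in sigma_finite_measure) bounded_density:
  assumes sets: "sets N = sets M" and fin: "finite_measure N"
    and le: "\<And>A. A \<in> sets M \<Longrightarrow> emeasure N A \<le> emeasure M A"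
  obtains D :: "'a \<Rightarrow> real" where "D \<in> borel_measurable M" "\<And>z. 0 \<le> D z" "\<And>z. D z \<le> 1"
    "N = density M (\<lambda>z. ennreal (D z))"
proof -
  define f where "f = RN_deriv M N"
  define D where "D z = enn2real (min 1 (f z))" for z
  define B where "B = {z \<in> space M. f z > 1}"
  have [measurable]: "f \<in> borel_measurable M" "B \<in> sets M"
    unfolding f_def B_def by measurable
  have D_meas [measurable]: "D \<in> borel_measurable M"
    unfolding D_def by measurable
  have "absolutely_continuous M N"
    unfolding absolutely_continuous_def
    using sets by (auto simp: null_sets_def) (metis le le_zero_eq)
  then have N: "density M f = N"
    unfolding f_def using sets by (rule density_RN_deriv)
  have f_int: "(\<integral>\<^sup>+z. f z * indicator A z \<partial>M) = emeasure N A" if "A \<in> sets M" for A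
    using that unfolding N[symmetric] by (simp add: emeasure_density)
  have "density M (\<lambda>z. f z * indicator B z) = density M (indicator B)"
  proof (rule measure_eqI)
    fix A assume "A \<in> sets (density M (\<lambda>z. f z * indicator B z))"
    then have [measurable]: "A \<in> sets M" by simp
    have "(\<integral>\<^sup>+z. f z * indicator (A \<inter> B) z \<partial>M) \<le> (\<integral>\<^sup>+z. indicator (A \<inter> B) z \<partial>M)"
      by (subst f_int) (simp_all add: le)
    moreover have "(\<integral>\<^sup>+z. indicator (A \<inter> B) z \<partial>M) \<le> (\<integral>\<^sup>+z. f z * indicator (A \<inter> B) z \<partial>M)"
      by (intro nn_integral_mono) (auto simp: B_def split: split_indicator)
    ultimately have "(\<integral>\<^sup>+z. f z * indicator (A \<inter> B) z \<partial>M) = (\<integral>\<^sup>+z. indicator (A \<inter> B) z \<partial>M)"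
      by (rule antisym)
    moreover have "emeasure (density M (\<lambda>z. f z * indicator B z)) A
        = (\<integral>\<^sup>+z. f z * indicator (A \<inter> B) z \<partial>M)"
      by (subst emeasure_density) (auto intro!: nn_integral_cong split: split_indicator)
    moreover have "emeasure (density M (indicator B)) A = (\<integral>\<^sup>+z. indicator (A \<inter> B) z \<partial>M)"
      by (simp add: emeasure_restricted Int_commute)
    ultimately show "emeasure (density M (\<lambda>z. f z * indicator B z)) A
        = emeasure (density M (indicator B)) A"
      by (simp only:)
  qed simp
  \<comment> \<open>Finiteness of \<open>N\<close> enters here: it lets equality of the two measures
    imply equality of their densities almost everywhere.\<close>
  moreover have "(\<integral>\<^sup>+z. f z * indicator B z \<partial>M) \<noteq> \<infinity>"
    using finite_measure.emeasure_finite[OF fin] by (simp add: f_int)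
  ultimately have "AE z in M. f z * indicator B z = indicator B z"
    by (subst (asm) finite_density_unique) auto
  then have "AE z in M. f z = ennreal (D z)"
    using AE_space
  proof eventually_elim
    case (elim z)
    then have "f z \<le> 1" by (cases "z \<in> B") (auto simp: B_def not_less)
    then show ?case by (simp add: D_def min_absorb2 le_less_trans)
  qed
  then have "N = density M (\<lambda>z. ennreal (D z))"
    unfolding N[symmetric] by (intro density_cong) (auto simp: D_def)
  moreover have "D z \<le> 1" for z
    unfolding D_def by (rule enn2real_leI) auto
  moreover have "0 \<le> D z" for z
    by (simp add: D_def)
  ultimately show ?thesis
    using that[of D] D_meas by blast
qed

text \<open>It is built from \<open>peano_floor\<close>, whose measurability is established, and cut
  off to \<open>{0..<1}\<close> so that its total mass is at most 1 for every real
  \<open>t\<close>.\<close>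

definition occupation_measure :: "real \<Rightarrow> real measure" where
  "occupation_measure t =
     distr (density lborel (\<lambda>s. ennreal (indicator ({0..t} \<inter> {0..<1}) s))) borel peano_floor"

lemma occupation_measure_le:
  assumes [measurable]: "A \<in> sets borel"
  shows "emeasure (occupation_measure t) A \<le> emeasure lborel ({0..<1} \<inter> peano_floor -` A)"
proof -
  have [measurable]: "peano_floor -` A \<in> sets borel"
    by (rule measurable_sets_borel[OF measurable_peano_floor]) simp
  have "emeasure (occupation_measure t) A = emeasure lborel ({0..t} \<inter> {0..<1} \<inter> peano_floor -` A)"
    unfolding occupation_measure_def
    by (subst emeasure_distr) (simp_all add: ennreal_indicator emeasure_restricted)
  also have "\<dots> \<le> emeasure lborel ({0..<1} \<inter> peano_floor -` A)"
    by (intro emeasure_mono) auto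
  finally show ?thesis .
qed

lemma occupation_measure_density:
  obtains D :: "real \<Rightarrow> real" where "D \<in> borel_measurable borel" "\<And>z. 0 \<le> D z" "\<And>z. D z \<le> 1"
    "occupation_measure t = density lborel (\<lambda>z. ennreal (D z))"
proof (rule lborel.bounded_density)
  show "sets (occupation_measure t) = sets lborel"
    by (simp add: occupation_measure_def)
  show "finite_measure (occupation_measure t)"
  proof
    have "emeasure (occupation_measure t) UNIV \<le> 1"
      using occupation_measure_le[of UNIV t] by simp
    then show "emeasure (occupation_measure t) (space (occupation_measure t)) \<noteq> \<infinity>"
      by (auto simp: occupation_measure_def top_unique)
  qed
  show "emeasure (occupation_measure t) A \<le> emeasure lborel A" if "A \<in> sets lborel" for A
    using order_trans[OF occupation_measure_le emeasure_peano_floor_vimage_le, of A] that by simp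
qed (use that in simp)

lemma occupation_integral:
  fixes g :: "real \<Rightarrow> real"
  assumes t: "t \<in> {0..1}" and [measurable]: "g \<in> borel_measurable borel" and g: "bounded (range g)"
  shows "set_integrable lborel {0..t} (\<lambda>s. g (peano_x s))"
    and "integrable (occupation_measure t) g"
    and "(LINT s:{0..t}|lborel. g (peano_x s)) = integral\<^sup>L (occupation_measure t) g"
proof -
  let ?I = "{0..t} \<inter> {0..<1}"
  let ?M = "density lborel (\<lambda>s. ennreal (indicator ?I s))"
  \<comment> \<open>The exceptional set: at \<open>1\<close> the two intervals can differ, and at
    triadic rationals \<open>peano_x\<close> may use another expansion. Being countable, it is null,
    so integrals transfer without measurability of \<open>peano_x\<close>.\<close>
  define X where "X = insert 1 triadic_rationals"
  have X: "countable X" by (simp add: X_def countable_triadic)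
  have eq: "indicator {0..t} s *\<^sub>R g (peano_x s) = indicator ?I s *\<^sub>R g (peano_floor s)"
    if "s \<notin> X" for s
    using that t by (auto simp: X_def peano_x_eq_peano_floor split: split_indicator)
  obtain K where K: "\<And>z. norm (g z) \<le> K"
    using g by (auto simp: bounded_iff)
  have "set_integrable lborel ?I (\<lambda>s. g (peano_floor s))"
  proof (rule set_integrable_bound)
    show "set_integrable lborel ?I (\<lambda>_. K)"
      unfolding set_integrable_def using t
      by (intro integrable_scaleR_left integrable_real_indicator)
         (auto intro: le_less_trans[OF emeasure_mono[of _ "{0..1}"]])
  qed (use K in \<open>auto simp: set_borel_measurable_def intro: order_trans[OF _ abs_ge_self]\<close>)
  then have int: "integrable lborel (\<lambda>s. indicator ?I s *\<^sub>R g (peano_floor s))"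
    by (simp add: set_integrable_def)
  have "integrable lborel (\<lambda>s. indicator {0..t} s *\<^sub>R g (peano_x s)) \<longleftrightarrow>
      integrable lborel (\<lambda>s. indicator ?I s *\<^sub>R g (peano_floor s))"
    by (rule integrable_discrete_difference[OF X]) (simp, simp, rule eq)
  with int show "set_integrable lborel {0..t} (\<lambda>s. g (peano_x s))"
    by (simp add: set_integrable_def)
  have "integrable ?M (\<lambda>s. g (peano_floor s))"
    using int by (subst integrable_density) auto
  then show "integrable (occupation_measure t) g"
    unfolding occupation_measure_def by (subst integrable_distr_eq) auto
  have "(\<integral>s. indicator {0..t} s *\<^sub>R g (peano_x s) \<partial>lborel)
      = (\<integral>s. indicator ?I s *\<^sub>R g (peano_floor s) \<partial>lborel)"
    by (rule integral_discrete_difference[OF X]) (simp, simp, rule eq)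
  also have "\<dots> = integral\<^sup>L ?M (\<lambda>s. g (peano_floor s))"
    by (subst integral_density) auto
  also have "\<dots> = integral\<^sup>L (occupation_measure t) g"
    unfolding occupation_measure_def by (subst integral_distr) auto
  finally show "(LINT s:{0..t}|lborel. g (peano_x s)) = integral\<^sup>L (occupation_measure t) g"
    by (simp add: set_lebesgue_integral_def)
qed

theorem theorem3p1:
  "\<exists>L :: real \<Rightarrow> real \<Rightarrow> real.
     is_local_time peano_x L \<and> (\<forall>t\<in>{0..1}. \<forall>z. L t z \<le> 1)"
proof -
  have "\<exists>D :: real \<Rightarrow> real. D \<in> borel_measurable borel \<and> (\<forall>z. 0 \<le> D z \<and> D z \<le> 1) \<and>
      occupation_measure t = density lborel (\<lambda>z. ennreal (D z))" for t
    by (rule occupation_measure_density[of t]) blast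
  then have "\<forall>t. \<exists>D :: real \<Rightarrow> real. D \<in> borel_measurable borel \<and> (\<forall>z. 0 \<le> D z \<and> D z \<le> 1) \<and>
      occupation_measure t = density lborel (\<lambda>z. ennreal (D z))" ..
  \<comment> \<open>The densities are chosen independently for each \<open>t\<close>; a local time
    asks for measurability in \<open>z\<close> at fixed \<open>t\<close> only.\<close>
  from choice[OF this] obtain L :: "real \<Rightarrow> real \<Rightarrow> real"
    where L [measurable]: "\<And>t. L t \<in> borel_measurable borel"
    and bounds: "\<And>t z. 0 \<le> L t z" "\<And>t z. L t z \<le> 1"
    and density: "\<And>t. occupation_measure t = density lborel (\<lambda>z. ennreal (L t z))"
    by blast
  have "is_local_time peano_x L"
    unfolding is_local_time_def
  proof (intro ballI conjI allI impI bounds(1) L; elim conjE)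
    fix t :: real and g :: "real \<Rightarrow> real"
    assume t: "t \<in> {0..1}" and g [measurable]: "g \<in> borel_measurable borel" and bd: "bounded (range g)"
    note occ = occupation_integral[OF t g bd]
    show "set_integrable lborel {0..t} (\<lambda>s. g (peano_x s))" by (rule occ)
    have "integrable (occupation_measure t) g \<longleftrightarrow> integrable lborel (\<lambda>z. L t z *\<^sub>R g z)"
      unfolding density using bounds(1) by (intro integrable_density) auto
    with occ(2) show "integrable lborel (\<lambda>z. g z * L t z)" by (simp add: mult.commute)
    have "integral\<^sup>L (occupation_measure t) g = (\<integral>z. L t z *\<^sub>R g z \<partial>lborel)"
      unfolding density using bounds(1) by (intro integral_density) auto
    with occ(3) show "(LINT s:{0..t}|lborel. g (peano_x s)) = (\<integral>z. g z * L t z \<partial>lborel)"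
      by (simp add: mult.commute)
  qed
  with bounds show ?thesis by blast
qed

end
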